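(* Let $\varepsilon>0$. There exists a constant $C=C(\varepsilon)>0$ such that if $G$ is an $(n,d,\lambda)$-graph with $d/\lambda\ge C$, then $ST(G)\le (1+\varepsilon)\,n\log n$; that is, a simple random walk on $G$ of length $(1+\varepsilon)n\log n$ visits every vertex of $G$ with high probability, uniformly over all starting vertices.
   Context: An $(n,d,\lambda)$-graph is a $d$-regular simple graph on $n$ vertices in which every eigenvalue of the adjacency matrix other than the largest one ($=d$) has absolute value at most $\lambda$. A simple random walk moves at each step to a uniformly random neighbor of the current vertex. The strong cover time $ST(G)$ is the minimum integer $t$ such that a simple random walk of length $t$ visits every vertex of $G$ with high probability, uniformly over all starting vertices. "With high probability" means with probability tending to $1$ as $n\to\infty$. $\log$ is the natural logarithm; floors/ceilings are omitted. *)

theory Defs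
  imports
    "HOL-Probability.Probability"
    "HOL-Library.Extended_Nat"
    "Jordan_Normal_Form.Char_Poly"
    "Graph_Theory.Pair_Digraph"
begin

(* A simple graph is a pair_graph (finite, loop-free, symmetric set of arcs); its vertices are
   numbered 0, ..., n - 1 so that n can be quantified inside the statement. *)

definition adjacency_matrix :: "nat \<Rightarrow> nat pair_pre_digraph \<Rightarrow> real mat" where
  "adjacency_matrix n G = mat n n (\<lambda>(i, j). if (i, j) \<in> parcs G then 1 else 0)"

(* The eigenvalues are taken with multiplicity, as roots of the characteristic polynomial (all of
   them are real, the matrix being symmetric).  Exactly one copy of the largest eigenvalue d is
   removed: if d occurs again, e.g. because G is disconnected, that copy has to be bounded by lam. *)
definition ndl_graph :: "nat \<Rightarrow> nat \<Rightarrow> real \<Rightarrow> nat pair_pre_digraph \<Rightarrow> bool" where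
  "ndl_graph n d lam G \<longleftrightarrow>
     pair_graph G \<and> pverts G = {0..<n} \<and>
     (\<forall>v\<in>pverts G. out_degree (with_proj G) v = d) \<and>
     (\<forall>\<mu>\<in>#proots (char_poly (adjacency_matrix n G)) - {#real d#}. \<bar>\<mu>\<bar> \<le> lam)"

(* The trajectory [v, X1, ..., Xt] of a simple random walk with t steps started at v.  It is
   meaningful only if no vertex is isolated, since pmf_of_set {} is unspecified. *)
primrec random_walk :: "'a pair_pre_digraph \<Rightarrow> nat \<Rightarrow> 'a \<Rightarrow> 'a list pmf" where
  "random_walk G 0 v = return_pmf [v]"
| "random_walk G (Suc t) v =
     bind_pmf (pmf_of_set (parcs G `` {v})) (\<lambda>w. map_pmf ((#) v) (random_walk G t w))"

definition cover_prob :: "'a pair_pre_digraph \<Rightarrow> nat \<Rightarrow> 'a \<Rightarrow> real" where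
  "cover_prob G t v = measure_pmf.prob (random_walk G t v) {xs. pverts G \<subseteq> set xs}"

(* "With high probability" has no meaning for a single graph; here it is replaced by "with
   probability at least 1 - \<delta>", where \<delta> is arbitrary and fixed before n tends to infinity.
   The value is \<infinity> if there is no such t. *)
definition strong_cover_time :: "real \<Rightarrow> 'a pair_pre_digraph \<Rightarrow> enat" where
  "strong_cover_time \<delta> G = Inf {enat t |t. \<forall>v\<in>pverts G. cover_prob G t v \<ge> 1 - \<delta>}"

end

theory Submission
  imports Defs
begin

text \<open>Let \<open>P = A / d\<close> be the transition matrix and \<open>\<theta> = \<lambda> / d\<close>. The functions
  \<open>h\<^sub>t v = Pr\<^sub>v (u is not visited in t steps)\<close> satisfy \<open>h\<^sub>t\<^sub>+\<^sub>1 = Q P h\<^sub>t\<close>, where \<open>Q\<close> sets the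
  entry at \<open>u\<close> to 0. Splitting vectors that vanish at \<open>u\<close> into mean and sum-zero part shows that
  \<open>Q P Q\<close> has norm at most \<open>\<rho> = 1 - (1 - \<theta>) / n\<close>, so \<open>\<parallel>h\<^sub>t\<parallel> \<le> \<rho>\<^sup>t sqrt n\<close>. Dropping the
  avoidance constraint during the first \<open>s\<close> steps lets the walk mix:
  \<open>h\<^sub>s\<^sub>+\<^sub>t v \<le> (P\<^sup>s h\<^sub>t) v \<le> (1 / sqrt n + \<theta>\<^sup>s) \<parallel>h\<^sub>t\<parallel>\<close>, which is at most \<open>2 \<rho>\<^sup>t\<close> as soon as
  \<open>s \<ge> ln n\<close> and \<open>\<theta> \<le> 1 / 2\<close>. With \<open>(1 - \<theta>) (1 + \<epsilon>) \<ge> 1 + \<epsilon> / 2\<close>, a union bound over \<open>u\<close> leaves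
  a failure probability of order \<open>n\<close> to the power \<open>- \<epsilon> / 2\<close>.\<close>

subsection \<open>Symmetric matrices on sum-zero vectors\<close>

definition matrix_apply :: "'a set \<Rightarrow> ('a \<Rightarrow> 'a \<Rightarrow> real) \<Rightarrow> ('a \<Rightarrow> real) \<Rightarrow> 'a \<Rightarrow> real" where
  "matrix_apply V a f i = (\<Sum>j\<in>V. a i j * f j)"

lemma matrix_apply_cong:
  "(\<And>j. j \<in> V \<Longrightarrow> f j = g j) \<Longrightarrow> matrix_apply V a f i = matrix_apply V a g i"
  by (simp add: matrix_apply_def)

lemma matrix_apply_add:
  "matrix_apply V a (\<lambda>j. f j + g j) i = matrix_apply V a f i + matrix_apply V a g i"
  by (simp add: matrix_apply_def distrib_left sum.distrib)

lemma matrix_apply_diff: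
  "matrix_apply V a (\<lambda>j. f j - g j) i = matrix_apply V a f i - matrix_apply V a g i"
  by (simp add: matrix_apply_def right_diff_distrib sum_subtractf)

lemma matrix_apply_scale:
  "matrix_apply V a (\<lambda>j. c * f j) i = c * matrix_apply V a f i"
  by (simp add: matrix_apply_def sum_distrib_left mult_ac)

lemma matrix_apply_self_adjoint:
  assumes "\<And>i j. i \<in> V \<Longrightarrow> j \<in> V \<Longrightarrow> a i j = a j i"
  shows "(\<Sum>i\<in>V. f i * matrix_apply V a g i) = (\<Sum>i\<in>V. matrix_apply V a f i * g i)"
proof -
  have "(\<Sum>i\<in>V. f i * matrix_apply V a g i) = (\<Sum>i\<in>V. \<Sum>j\<in>V. a i j * f i * g j)"
    by (simp add: matrix_apply_def sum_distrib_left mult_ac)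
  also have "\<dots> = (\<Sum>j\<in>V. \<Sum>i\<in>V. a i j * f i * g j)"
    by (rule sum.swap)
  also have "\<dots> = (\<Sum>j\<in>V. matrix_apply V a f j * g j)"
    unfolding matrix_apply_def sum_distrib_right
    by (intro sum.cong refl) (simp add: assms)
  finally show ?thesis .
qed

lemma sum_matrix_apply:
  assumes "\<And>i j. i \<in> V \<Longrightarrow> j \<in> V \<Longrightarrow> a i j = a j i"
    and "\<And>i. i \<in> V \<Longrightarrow> (\<Sum>j\<in>V. a i j) = c"
  shows "(\<Sum>i\<in>V. matrix_apply V a f i) = c * (\<Sum>i\<in>V. f i)"
proof -
  have "(\<Sum>i\<in>V. matrix_apply V a f i) = (\<Sum>i\<in>V. matrix_apply V a (\<lambda>_. 1) i * f i)"
    using matrix_apply_self_adjoint[OF assms(1), where f = "\<lambda>_. 1" and g = f] by simp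
  also have "\<dots> = (\<Sum>i\<in>V. c * f i)"
    by (intro sum.cong refl) (simp add: matrix_apply_def assms(2))
  finally show ?thesis by (simp add: sum_distrib_left)
qed

section \<open>Extremal eigenvectors among the sum-zero vectors\<close>

lemma L2_set_power2: "(L2_set f A)\<^sup>2 = (\<Sum>i\<in>A. (f i)\<^sup>2)"
  by (simp add: L2_set_def sum_nonneg)

text \<open>Functions carry the product topology, where this sphere is a closed part of a product of
  the compact factors [-1,1] (on \<open>V\<close>) and {0} (off \<open>V\<close>). Fixing the values
  off \<open>V\<close> is what gives compactness when the type has further elements. It supplies the
  maximiser in \<open>extremal_centered_eigenvector\<close>.\<close>

lemma compact_centered_unit_sphere:
  assumes "finite V"
  shows "compact {f :: 'a \<Rightarrow> real. (\<forall>i. i \<notin> V \<longrightarrow> f i = 0) \<and> (\<Sum>i\<in>V. f i) = 0 \<and> (\<Sum>i\<in>V. (f i)\<^sup>2) = 1}"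
    (is "compact ?S")
proof -
  let ?K = "PiE UNIV (\<lambda>i. if i \<in> V then {-1..1::real} else {0})"
  have "compactin (product_topology (\<lambda>i. euclidean) UNIV) ?K"
    unfolding compactin_PiE by (auto simp: compactin_euclidean_iff)
  then have K: "compact ?K"
    by (simp add: euclidean_product_topology compactin_euclidean_iff)
  have coord: "continuous_on UNIV (\<lambda>f::'a \<Rightarrow> real. f i)" for i
    by simp
  have "closed {f :: 'a \<Rightarrow> real. (\<Sum>i\<in>V. f i) = 0}"
    "closed {f :: 'a \<Rightarrow> real. (\<Sum>i\<in>V. (f i)\<^sup>2) = 1}"
    by (intro closed_Collect_eq continuous_intros coord)+
  then have cl: "closed ({f :: 'a \<Rightarrow> real. (\<Sum>i\<in>V. f i) = 0} \<inter> {f. (\<Sum>i\<in>V. (f i)\<^sup>2) = 1})"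
    by (rule closed_Int)
  have bd: "\<bar>f i\<bar> \<le> 1" if "(\<Sum>i\<in>V. (f i)\<^sup>2) = 1" "i \<in> V" for f :: "'a \<Rightarrow> real" and i
  proof -
    have "(f i)\<^sup>2 \<le> (\<Sum>i\<in>V. (f i)\<^sup>2)"
      using assms that(2) by (intro member_le_sum) auto
    then show ?thesis using that(1) by (simp add: abs_square_le_1)
  qed
  have "?S = ?K \<inter> ({f. (\<Sum>i\<in>V. f i) = 0} \<inter> {f. (\<Sum>i\<in>V. (f i)\<^sup>2) = 1})"
  proof (intro Set.set_eqI iffI)
    fix f assume "f \<in> ?S"
    then show "f \<in> ?K \<inter> ({f. (\<Sum>i\<in>V. f i) = 0} \<inter> {f. (\<Sum>i\<in>V. (f i)\<^sup>2) = 1})"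
      using bd[of f] by (auto simp: PiE_def Pi_def abs_le_iff minus_le_iff)
  next
    fix f assume f: "f \<in> ?K \<inter> ({f. (\<Sum>i\<in>V. f i) = 0} \<inter> {f. (\<Sum>i\<in>V. (f i)\<^sup>2) = 1})"
    then have "f i \<in> (if i \<in> V then {-1..1::real} else {0})" for i
      using PiE_mem[of f UNIV _ i] by blast
    then have "f i = 0" if "i \<notin> V" for i using that by (metis singletonD)
    then show "f \<in> ?S" using f by auto
  qed
  then show ?thesis using compact_Int_closed[OF K cl] by simp
qed

text \<open>The first-order condition at an extremum, in a form that avoids derivatives.\<close>

lemma linear_coeff_zero_of_nonneg_quadratic:
  fixes b c :: real
  assumes "\<And>t. 0 \<le> 2 * t * b + t\<^sup>2 * c"
  shows "b = 0"
proof (rule ccontr)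
  assume "b \<noteq> 0"
  have c: "c \<ge> 0" using assms[of 1] assms[of "-1"] by simp
  \<comment> \<open>Dividing by \<open>c + 1\<close> instead of \<open>c\<close> also covers
    \<open>c = 0\<close>; the quadratic then takes the value
    \<open>- t\<^sup>2 * (c + 2)\<close>.\<close>
  define t where "t = - b / (c + 1)"
  have tb: "t * (c + 1) = - b" using c by (simp add: t_def)
  have "2 * t * b + t\<^sup>2 * c = - t\<^sup>2 * (c + 2)"
  proof -
    have b: "b = - t * (c + 1)" using tb by simp
    show ?thesis by (subst b) (simp add: power2_eq_square algebra_simps)
  qed
  moreover have "t \<noteq> 0" using \<open>b \<noteq> 0\<close> tb by auto
  then have "0 < t\<^sup>2 * (c + 2)" using c by (intro mult_pos_pos) auto
  ultimately show False using assms[of t] by simp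
qed

text \<open>The maximiser \<open>g\<close> of \<open>\<parallel>a f\<parallel>\<close> on the unit sphere of the sum-zero vectors is an
  eigenvector of the square of \<open>a\<close>, say for the eigenvalue \<open>M\<^sup>2\<close>; then either \<open>g\<close> or
  \<open>a g + M g\<close> is an eigenvector of \<open>a\<close>.\<close>

lemma extremal_centered_eigenvector:
  fixes V :: "'a set" and a :: "'a \<Rightarrow> 'a \<Rightarrow> real" and g0 :: "'a \<Rightarrow> real"
  assumes fin: "finite V"
    and sym: "\<And>i j. i \<in> V \<Longrightarrow> j \<in> V \<Longrightarrow> a i j = a j i"
    and row: "\<And>i. i \<in> V \<Longrightarrow> (\<Sum>j\<in>V. a i j) = c"
    and g0: "(\<Sum>i\<in>V. g0 i) = 0" "\<exists>i\<in>V. g0 i \<noteq> 0"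
  obtains g \<mu> where "(\<Sum>i\<in>V. g i) = 0" "\<exists>i\<in>V. g i \<noteq> 0"
    "\<And>i. i \<in> V \<Longrightarrow> matrix_apply V a g i = \<mu> * g i"
    "\<And>f. (\<Sum>i\<in>V. f i) = 0 \<Longrightarrow> L2_set (matrix_apply V a f) V \<le> \<bar>\<mu>\<bar> * L2_set f V"
proof -
  let ?A = "matrix_apply V a"
  define N where "N f = (\<Sum>i\<in>V. (?A f i)\<^sup>2)" for f
  define Q where "Q f = (\<Sum>i\<in>V. (f i)\<^sup>2)" for f :: "'a \<Rightarrow> real"
  let ?S = "{f :: 'a \<Rightarrow> real. (\<forall>i. i \<notin> V \<longrightarrow> f i = 0) \<and> (\<Sum>i\<in>V. f i) = 0 \<and> (\<Sum>i\<in>V. (f i)\<^sup>2) = 1}"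
  have Qpos: "Q f > 0" if "\<exists>i\<in>V. f i \<noteq> 0" for f
    using that fin by (auto simp: Q_def intro: sum_pos2)
  \<comment> \<open>Normalising and resetting the values off \<open>V\<close> to 0 lands in
    \<open>?S\<close> without changing the direction of \<open>f\<close> on
    \<open>V\<close>.\<close>
  define scaled where "scaled f = (\<lambda>i. if i \<in> V then f i / sqrt (Q f) else 0)" for f :: "'a \<Rightarrow> real"
  have scaled_S: "scaled f \<in> ?S" if "(\<Sum>i\<in>V. f i) = 0" "\<exists>i\<in>V. f i \<noteq> 0" for f
  proof -
    have "(\<Sum>i\<in>V. scaled f i) = (\<Sum>i\<in>V. f i) / sqrt (Q f)"
      by (simp add: scaled_def sum_divide_distrib)
    moreover have "(\<Sum>i\<in>V. (scaled f i)\<^sup>2) = Q f / Q f"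
      using Qpos[OF that(2)] by (simp add: scaled_def power_divide sum_divide_distrib[symmetric]) (simp add: Q_def)
    ultimately show ?thesis using that Qpos[OF that(2)] by (simp add: scaled_def)
  qed
  have coord: "continuous_on UNIV (\<lambda>f::'a \<Rightarrow> real. f i)" for i
    by simp
  have "continuous_on ?S N"
    unfolding N_def matrix_apply_def
    by (intro continuous_intros continuous_on_subset[OF coord]) auto
  moreover have "?S \<noteq> {}" using scaled_S[OF g0] by blast
  ultimately have "\<exists>g\<in>?S. \<forall>f\<in>?S. N f \<le> N g"
    by (intro continuous_attains_sup compact_centered_unit_sphere fin)
  then obtain g where g: "g \<in> ?S" and max: "\<And>f. f \<in> ?S \<Longrightarrow> N f \<le> N g"
    by blast
  define m where "m = N g"
  have bound: "N f \<le> m * Q f" if "(\<Sum>i\<in>V. f i) = 0" for f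
  proof (cases "\<exists>i\<in>V. f i \<noteq> 0")
    case True
    have eq: "?A (scaled f) i = inverse (sqrt (Q f)) * ?A f i" for i
      by (subst matrix_apply_scale[symmetric], rule matrix_apply_cong) (simp add: scaled_def field_simps)
    have "N (scaled f) = N f / Q f"
      using Qpos[OF True] unfolding N_def eq
      by (simp add: power_mult_distrib power_inverse sum_distrib_left[symmetric] divide_inverse mult.commute)
    then have "N f / Q f \<le> m" using max[OF scaled_S[OF that True]] by (simp add: m_def)
    then show ?thesis using Qpos[OF True] by (simp add: pos_divide_le_eq)
  next
    case False
    then have "?A f i = 0" for i by (simp add: matrix_apply_def)
    moreover have "Q f = 0" using False by (simp add: Q_def)
    ultimately show ?thesis by (simp add: N_def)
  qed
  have gsum: "(\<Sum>i\<in>V. g i) = 0" and gQ: "Q g = 1" using g by (auto simp: Q_def)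
  \<comment> \<open>The residual of the eigenvector equation for the square of \<open>a\<close>. It
    is itself sum-zero, so \<open>g\<close> may be perturbed in its direction; since
    \<open>m * Q - N\<close> is nonnegative and vanishes at \<open>g\<close>, the first-order term,
    which is the squared norm of \<open>h\<close>, must be 0.\<close>
  define h where "h i = m * g i - ?A (?A g) i" for i
  have hsum: "(\<Sum>i\<in>V. h i) = 0"
    by (simp add: h_def sum_subtractf sum_distrib_left[symmetric] sum_matrix_apply[OF sym row] gsum)
  have "(\<Sum>i\<in>V. h i * h i) = 0"
  proof (rule linear_coeff_zero_of_nonneg_quadratic)
    fix t :: real
    have le: "N (\<lambda>i. g i + t * h i) \<le> m * Q (\<lambda>i. g i + t * h i)"
      by (rule bound) (simp add: sum.distrib sum_distrib_left[symmetric] gsum hsum)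
    have expN: "N (\<lambda>i. g i + t * h i) = m + 2 * t * (\<Sum>i\<in>V. ?A g i * ?A h i) + t\<^sup>2 * N h"
      unfolding m_def N_def matrix_apply_add matrix_apply_scale
      by (simp add: power2_sum power_mult_distrib sum.distrib sum_distrib_left mult_ac)
    have expQ: "Q (\<lambda>i. g i + t * h i) = 1 + 2 * t * (\<Sum>i\<in>V. g i * h i) + t\<^sup>2 * Q h"
      unfolding gQ[symmetric] unfolding Q_def
      by (simp add: power2_sum power_mult_distrib sum.distrib sum_distrib_left mult_ac)
    have adj: "(\<Sum>i\<in>V. ?A g i * ?A h i) = (\<Sum>i\<in>V. ?A (?A g) i * h i)"
      by (rule matrix_apply_self_adjoint[OF sym])
    have hh: "(\<Sum>i\<in>V. h i * h i) = m * (\<Sum>i\<in>V. g i * h i) - (\<Sum>i\<in>V. ?A (?A g) i * h i)"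
      unfolding sum_distrib_left sum_subtractf[symmetric]
      by (intro sum.cong refl) (subst (1) h_def, simp add: algebra_simps)
    show "0 \<le> 2 * t * (\<Sum>i\<in>V. h i * h i) + t\<^sup>2 * (m * Q h - N h)"
      using le unfolding expN expQ adj hh by (simp add: algebra_simps)
  qed
  then have AAg: "?A (?A g) i = m * g i" if "i \<in> V" for i
    using that fin by (simp add: sum_nonneg_eq_0_iff h_def)
  define M where "M = sqrt m"
  have "m \<ge> 0" by (simp add: m_def N_def sum_nonneg)
  then have M: "M \<ge> 0" "M * M = m" by (auto simp: M_def)
  have L2: "L2_set (?A f) V \<le> M * L2_set f V" if "(\<Sum>i\<in>V. f i) = 0" for f
  proof -
    have "sqrt (N f) \<le> sqrt (m * Q f)" by (rule real_sqrt_le_mono[OF bound[OF that]])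
    then show ?thesis by (simp add: L2_set_def N_def Q_def M_def real_sqrt_mult)
  qed
  define k where "k i = ?A g i + M * g i" for i
  show thesis
  proof (cases "\<exists>i\<in>V. k i \<noteq> 0")
    case True
    show thesis
    proof (rule that[of k M])
      show "(\<Sum>i\<in>V. k i) = 0"
        by (simp add: k_def sum.distrib sum_distrib_left[symmetric] sum_matrix_apply[OF sym row] gsum)
      show "?A k i = M * k i" if "i \<in> V" for i
        unfolding k_def matrix_apply_add matrix_apply_scale AAg[OF that] M(2)[symmetric]
        by (simp add: algebra_simps)
    qed (use True L2 M in auto)
  next
    case False
    show thesis
    proof (rule that[of g "- M"])
      show "\<exists>i\<in>V. g i \<noteq> 0" 
      proof (rule ccontr)
        assume "\<not> ?thesis"
        then have "Q g = 0" by (simp add: Q_def)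
        then show False using gQ by simp
      qed
      show "?A g i = - M * g i" if "i \<in> V" for i
        using False that by (auto simp: k_def add_eq_0_iff2)
    qed (use gsum L2 M in auto)
  qed
qed

text \<open>The all-ones vector is an eigenvector for \<open>c\<close>. Taking it as first basis
  vector (first column of \<open>P\<close>, with inverse \<open>Q\<close>) makes the matrix block
  triangular with diagonal blocks \<open>c\<close> and \<open>?D\<close>; the latter is the action
  on the quotient by the constant vectors. This isolates the one copy of \<open>d\<close> that
  \<open>ndl_graph\<close> removes.\<close>

lemma char_poly_constant_row_sums:
  fixes a :: "nat \<Rightarrow> nat \<Rightarrow> real"
  assumes row: "\<And>i. i < Suc m \<Longrightarrow> (\<Sum>j<Suc m. a i j) = c"
  shows "char_poly (mat (Suc m) (Suc m) (\<lambda>(i, j). a i j)) =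
    [:- c, 1:] * char_poly (mat m m (\<lambda>(i, j). a (Suc i) (Suc j) - a 0 (Suc j)))"
proof -
  let ?n = "Suc m"
  let ?A = "mat ?n ?n (\<lambda>(i, j). a i j)"
  let ?D = "mat m m (\<lambda>(i, j). a (Suc i) (Suc j) - a 0 (Suc j))"
  let ?r = "mat 1 m (\<lambda>(i, j). a 0 (Suc j))"
  let ?c = "mat 1 1 (\<lambda>(i, j). c)"
  let ?B = "four_block_mat ?c ?r (0\<^sub>m m 1) ?D"
  define P :: "real mat" where "P = mat ?n ?n (\<lambda>(i, j). if j = 0 then 1 else if i = j then 1 else 0)"
  define Q :: "real mat" where "Q = mat ?n ?n (\<lambda>(i, j). if j = 0 then (if i = 0 then 1 else -1) else if i = j then 1 else 0)"
  have carr: "P \<in> carrier_mat ?n ?n" "Q \<in> carrier_mat ?n ?n" "?A \<in> carrier_mat ?n ?n"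
    "?B \<in> carrier_mat ?n ?n"
    by (auto simp: P_def Q_def)
  have delta: "(if b then 1 else 0) * x = (if b then x else 0)"
    "x * (if b then 1 else 0) = (if b then x else 0)" for b and x :: real
    by simp_all
  have PQ: "P * Q = 1\<^sub>m ?n"
  proof (rule eq_matI)
    fix i j assume "i < dim_row (1\<^sub>m ?n :: real mat)" "j < dim_col (1\<^sub>m ?n :: real mat)"
    then show "(P * Q) $$ (i, j) = 1\<^sub>m ?n $$ (i, j)"
      by (cases i; cases j)
        (simp_all add: P_def Q_def scalar_prod_def sum.atLeast0_lessThan_Suc_shift delta sum_negf
          del: sum.op_ivl_Suc)
  qed (auto simp: P_def Q_def)
  then have QP: "Q * P = 1\<^sub>m ?n"
    using mat_mult_left_right_inverse carr by blast
  have row': "a i 0 + (\<Sum>j = 0..<m. a i (Suc j)) = c" if "i < ?n" for i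
    using row[OF that] by (simp add: sum.lessThan_Suc_shift atLeast0LessThan del: sum.lessThan_Suc)
  have AP: "?A * P = P * ?B"
  proof (rule eq_matI)
    fix i j assume "i < dim_row (P * ?B)" "j < dim_col (P * ?B)"
    then have "i < ?n" "j < ?n" by (auto simp: P_def)
    then show "(?A * P) $$ (i, j) = (P * ?B) $$ (i, j)"
      using row'[of i]
      by (cases i; cases j)
        (simp_all add: P_def scalar_prod_def sum.atLeast0_lessThan_Suc_shift delta
          del: sum.op_ivl_Suc)
  qed (auto simp: P_def)
  have "?A = ?A * (P * Q)" unfolding PQ using carr by simp
  also have "\<dots> = P * ?B * Q" unfolding AP[symmetric] by (rule assoc_mult_mat[OF carr(3,1,2), symmetric])
  finally have "similar_mat_wit ?A ?B P Q"
    using carr PQ QP by (intro similar_mat_witI) auto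
  then have "char_poly ?A = char_poly ?B"
    by (intro char_poly_similar) (auto simp: similar_mat_def)
  also have "\<dots> = char_poly ?c * char_poly ?D"
    by (rule char_poly_four_block_zeros_col) auto
  also have "char_poly ?c = [:- c, 1:]"
    by (subst char_poly_upper_triangular[of _ 1]) (auto simp: diag_mat_def)
  finally show ?thesis .
qed

text \<open>A nonzero sum-zero vector is not constant, so its differences to \<open>g 0\<close> give
  a nonzero eigenvector of the quotient matrix \<open>?D\<close>. Hence \<mu> is a root of the
  cofactor of \<open>[:- c, 1:]\<close>. This covers \<mu> = c as well, where a second copy of
  \<open>c\<close> is present, as for disconnected regular graphs.\<close>

lemma centered_eigenvalue_in_proots:
  fixes a :: "nat \<Rightarrow> nat \<Rightarrow> real"
  assumes row: "\<And>i. i < n \<Longrightarrow> (\<Sum>j<n. a i j) = c"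
    and g: "(\<Sum>i<n. g i) = 0" "\<exists>i<n. g i \<noteq> 0"
    and ev: "\<And>i. i < n \<Longrightarrow> (\<Sum>j<n. a i j * g j) = \<mu> * g i"
  shows "\<mu> \<in># proots (char_poly (mat n n (\<lambda>(i, j). a i j))) - {#c#}"
proof -
  obtain m where n: "n = Suc m" using g(2) by (cases n) auto
  let ?D = "mat m m (\<lambda>(i, j). a (Suc i) (Suc j) - a 0 (Suc j))"
  let ?v = "vec m (\<lambda>i. g (Suc i) - g 0)"
  have D: "?D \<in> carrier_mat m m" by simp
  have row': "(\<Sum>j<m. a i (Suc j)) = c - a i 0" and ev': "(\<Sum>j<m. a i (Suc j) * g (Suc j)) = \<mu> * g i - a i 0 * g 0"
    if "i < n" for i
    using row[OF that] ev[OF that] unfolding n by (simp_all add: sum.lessThan_Suc_shift del: sum.lessThan_Suc)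
  have "?D *\<^sub>v ?v = \<mu> \<cdot>\<^sub>v ?v"
  proof (rule eq_vecI)
    fix i assume "i < dim_vec (\<mu> \<cdot>\<^sub>v ?v)"
    then have i: "i < m" by simp
    have "(?D *\<^sub>v ?v) $ i = (\<Sum>j<m. (a (Suc i) (Suc j) - a 0 (Suc j)) * (g (Suc j) - g 0))"
      using i by (simp add: scalar_prod_def atLeast0LessThan)
    also have "\<dots> = (\<Sum>j<m. a (Suc i) (Suc j) * g (Suc j)) - (\<Sum>j<m. a 0 (Suc j) * g (Suc j))
        - ((\<Sum>j<m. a (Suc i) (Suc j)) - (\<Sum>j<m. a 0 (Suc j))) * g 0"
      by (simp add: algebra_simps sum.distrib sum_subtractf sum_distrib_left)
    also have "\<dots> = \<mu> * (g (Suc i) - g 0)"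
    proof -
      have "Suc i < n" "0 < n" using i n by auto
      then show ?thesis by (simp only: row' ev') (simp add: algebra_simps)
    qed
    finally show "(?D *\<^sub>v ?v) $ i = (\<mu> \<cdot>\<^sub>v ?v) $ i" using i by simp
  qed simp
  moreover have "?v \<noteq> 0\<^sub>v m"
  proof
    assume eq: "?v = 0\<^sub>v m"
    have "g (Suc i) - g 0 = 0" if "i < m" for i
      using arg_cong[OF eq, of "\<lambda>v. v $ i"] that by simp
    then have const: "g i = g 0" if "i < n" for i
      using that by (cases i) (auto simp: n)
    have "(\<Sum>i<n. g i) = (\<Sum>i<n. g 0)"
      by (intro sum.cong refl const) simp
    then have "g 0 = 0" using g(1) n by simp
    then show False using g(2) const by metis
  qed
  ultimately have "eigenvalue ?D \<mu>"
    unfolding eigenvalue_def eigenvector_def by (intro exI[of _ ?v]) auto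
  then have root: "poly (char_poly ?D) \<mu> = 0"
    using eigenvalue_root_char_poly[OF D] by simp
  have nz: "char_poly ?D \<noteq> 0" using degree_monic_char_poly[OF D] by auto
  have "proots (char_poly (mat n n (\<lambda>(i, j). a i j))) = {#c#} + proots (char_poly ?D)"
    using nz row unfolding n
    by (subst char_poly_constant_row_sums) (auto simp: proots_mult simp del: mult_pCons_left)
  then show ?thesis using root nz by simp
qed

subsection \<open>Avoiding a vertex\<close>

text \<open>Everything the avoidance estimate uses about the walk; the spectrum enters only through
  \<open>contraction\<close>.\<close>

locale contracting_kernel =
  fixes V :: "'a set" and p :: "'a \<Rightarrow> 'a \<Rightarrow> real" and \<theta> :: real
  assumes finite_V: "finite V"
    and symmetric: "i \<in> V \<Longrightarrow> j \<in> V \<Longrightarrow> p i j = p j i"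
    and nonneg: "i \<in> V \<Longrightarrow> j \<in> V \<Longrightarrow> 0 \<le> p i j"
    and row_sum: "i \<in> V \<Longrightarrow> (\<Sum>j\<in>V. p i j) = 1"
    and theta: "0 \<le> \<theta>" "\<theta> \<le> 1"
    and contraction: "(\<Sum>i\<in>V. f i) = 0 \<Longrightarrow> L2_set (matrix_apply V p f) V \<le> \<theta> * L2_set f V"
begin

abbreviation "P \<equiv> matrix_apply V p"
abbreviation "n \<equiv> real (card V)"

definition mean :: "('a \<Rightarrow> real) \<Rightarrow> real" where
  "mean f = (\<Sum>i\<in>V. f i) / n"

lemma sum_minus_mean: "(\<Sum>i\<in>V. f i - mean f) = 0"
  using finite_V by (cases "V = {}") (auto simp: mean_def sum_subtractf)

lemma sum_P: "(\<Sum>i\<in>V. P f i) = (\<Sum>i\<in>V. f i)"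
  using sum_matrix_apply[where a = p and c = 1 and V = V] symmetric row_sum by simp

lemma P_split_mean: "i \<in> V \<Longrightarrow> P f i = mean f + P (\<lambda>j. f j - mean f) i"
  unfolding matrix_apply_diff by (simp add: matrix_apply_def sum_distrib_right[symmetric] row_sum)

lemma L2_set_split_mean:
  "(L2_set f V)\<^sup>2 = n * (mean f)\<^sup>2 + (L2_set (\<lambda>i. f i - mean f) V)\<^sup>2"
proof -
  have "(\<Sum>i\<in>V. (f i)\<^sup>2) = (\<Sum>i\<in>V. (f i - mean f)\<^sup>2 + (mean f)\<^sup>2 + 2 * mean f * (f i - mean f))"
    by (intro sum.cong refl) (simp add: power2_eq_square algebra_simps)
  also have "\<dots> = (\<Sum>i\<in>V. (f i - mean f)\<^sup>2) + n * (mean f)\<^sup>2"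
    using sum_minus_mean[of f] by (simp add: sum.distrib sum_distrib_left[symmetric])
  finally show ?thesis by (simp add: L2_set_power2)
qed

lemma inner_le_L2_set: "\<bar>\<Sum>i\<in>V. f i * g i\<bar> \<le> L2_set f V * L2_set g V"
proof -
  have "\<bar>\<Sum>i\<in>V. f i * g i\<bar> \<le> (\<Sum>i\<in>V. \<bar>f i\<bar> * \<bar>g i\<bar>)"
    by (rule order_trans[OF sum_abs]) (simp add: abs_mult)
  then show ?thesis using L2_set_mult_ineq order_trans by blast
qed

text \<open>Cauchy-Schwarz over the \<open>n - 1\<close> points other than \<open>u\<close>. This
  gain of \<open>1 / n\<close> is the source of the decay rate \<open>\<rho>\<close>.\<close>

lemma mean_power2_le_vanishing:
  assumes "u \<in> V" "f u = 0"
  shows "n * (mean f)\<^sup>2 \<le> (1 - 1 / n) * (L2_set f V)\<^sup>2"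
proof -
  have n: "n > 0" using assms finite_V by (simp add: card_gt_0_iff) blast
  have "(\<Sum>i\<in>V. f i)\<^sup>2 = (\<Sum>i\<in>V - {u}. 1 * f i)\<^sup>2"
    using assms finite_V by (simp add: sum.remove)
  also have "\<dots> \<le> (\<Sum>i\<in>V - {u}. 1\<^sup>2) * (\<Sum>i\<in>V - {u}. (f i)\<^sup>2)"
    by (rule Cauchy_Schwarz_ineq_sum)
  also have "\<dots> = (n - 1) * (\<Sum>i\<in>V. (f i)\<^sup>2)"
    using assms finite_V n by (simp add: sum.remove[of V u] of_nat_diff)
  finally have "(\<Sum>i\<in>V. f i)\<^sup>2 \<le> (n - 1) * (L2_set f V)\<^sup>2" by (simp add: L2_set_power2)
  then have "(\<Sum>i\<in>V. f i)\<^sup>2 / n \<le> (n - 1) * (L2_set f V)\<^sup>2 / n"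
    using n by (intro divide_right_mono) auto
  moreover have "n * (mean f)\<^sup>2 = (\<Sum>i\<in>V. f i)\<^sup>2 / n"
    using n by (simp add: mean_def power2_eq_square)
  moreover have "(1 - 1 / n) * (L2_set f V)\<^sup>2 = (n - 1) * (L2_set f V)\<^sup>2 / n"
    using n by (simp add: field_simps)
  ultimately show ?thesis by simp
qed

definition \<rho> :: real where "\<rho> = 1 - (1 - \<theta>) / n"

lemma rho_nonneg: "V \<noteq> {} \<Longrightarrow> 0 \<le> \<rho>"
proof -
  assume "V \<noteq> {}"
  then have "n \<ge> 1" using finite_V by (simp add: Suc_leI card_gt_0_iff)
  then show ?thesis using theta by (simp add: \<rho>_def field_simps)
qed

text \<open>Writing the bilinear form as a \<open>(1 - \<theta>)\<close>-share of the product of the means plus a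
  \<open>\<theta>\<close>-share of the full inner product keeps the loss linear in \<open>1 / n\<close> with constant
  \<open>1 - \<theta>\<close>; bounding \<open>\<parallel>P f\<parallel>\<close> alone would cost a factor of 2.\<close>

lemma inner_P_vanishing:
  assumes u: "u \<in> V" "f u = 0" "h u = 0"
  shows "(\<Sum>i\<in>V. h i * P f i) \<le> \<rho> * L2_set h V * L2_set f V"
proof -
  define f' where "f' i = f i - mean f" for i
  define h' where "h' i = h i - mean h" for i
  define F H where "F = L2_set f V" and "H = L2_set h V"
  define F' H' where "F' = L2_set f' V" and "H' = L2_set h' V"
  \<comment> \<open>The norms of the constant parts of \<open>f\<close> and \<open>h\<close>, so
    that \<open>F2\<close> and \<open>H2\<close> below are Pythagoras.\<close>
  define x y where "x = sqrt n * \<bar>mean f\<bar>" and "y = sqrt n * \<bar>mean h\<bar>"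
  have n: "n > 0" using u finite_V by (simp add: card_gt_0_iff) blast
  then have n1: "0 \<le> 1 - 1 / n" using u finite_V
    by (simp add: field_simps Suc_leI card_gt_0_iff)
  have nn: "F \<ge> 0" "H \<ge> 0" "F' \<ge> 0" "H' \<ge> 0" "x \<ge> 0" "y \<ge> 0"
    by (auto simp: F_def H_def F'_def H'_def x_def y_def)
  have xy2: "x\<^sup>2 = n * (mean f)\<^sup>2" "y\<^sup>2 = n * (mean h)\<^sup>2"
    by (auto simp: x_def y_def power_mult_distrib)
  have F2: "F\<^sup>2 = x\<^sup>2 + F'\<^sup>2" and H2: "H\<^sup>2 = y\<^sup>2 + H'\<^sup>2"
    unfolding xy2 F_def H_def F'_def H'_def f'_def h'_def by (rule L2_set_split_mean)+
  have sum0: "(\<Sum>i\<in>V. f' i) = 0" "(\<Sum>i\<in>V. h' i) = 0"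
    unfolding f'_def h'_def by (rule sum_minus_mean)+
  have "(\<Sum>i\<in>V. h i * P f i) = (\<Sum>i\<in>V. (mean h + h' i) * (mean f + P f' i))"
    by (intro sum.cong refl) (simp add: P_split_mean[of _ f] h'_def f'_def[abs_def])
  also have "\<dots> = n * (mean h * mean f) + mean h * (\<Sum>i\<in>V. P f' i) + mean f * (\<Sum>i\<in>V. h' i)
      + (\<Sum>i\<in>V. h' i * P f' i)"
    by (simp add: distrib_left distrib_right sum.distrib sum_distrib_left sum_distrib_right mult_ac)
  also have "\<dots> = n * (mean h * mean f) + (\<Sum>i\<in>V. h' i * P f' i)"
    by (simp add: sum_P sum0)
  also have "n * (mean h * mean f) \<le> x * y"
  proof -
    have "x * y = n * \<bar>mean h * mean f\<bar>" by (simp add: x_def y_def abs_mult)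
    then show ?thesis using n by (simp add: mult_left_mono)
  qed
  also have "(\<Sum>i\<in>V. h' i * P f' i) \<le> H' * (\<theta> * F')"
  proof -
    have "(\<Sum>i\<in>V. h' i * P f' i) \<le> H' * L2_set (P f') V"
      using inner_le_L2_set[of h' "P f'"] by (simp add: H'_def)
    also have "\<dots> \<le> H' * (\<theta> * F')"
      unfolding F'_def using nn by (intro mult_left_mono contraction sum0) auto
    finally show ?thesis .
  qed
  finally have "(\<Sum>i\<in>V. h i * P f i) \<le> (1 - \<theta>) * (x * y) + \<theta> * (x * y + H' * F')"
    by (simp add: algebra_simps)
  moreover have "x * y \<le> (1 - 1 / n) * (H * F)"
  proof (rule power2_le_imp_le)
    have "x\<^sup>2 * y\<^sup>2 \<le> ((1 - 1 / n) * F\<^sup>2) * ((1 - 1 / n) * H\<^sup>2)"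
      unfolding xy2 F_def H_def
      by (rule mult_mono[OF mean_power2_le_vanishing[of u f] mean_power2_le_vanishing[of u h]])
        (use n1 u in auto)
    then show "(x * y)\<^sup>2 \<le> ((1 - 1 / n) * (H * F))\<^sup>2"
      by (simp add: power_mult_distrib power2_eq_square mult_ac)
  qed (use n1 nn in auto)
  \<comment> \<open>Cauchy-Schwarz in the plane for (y, H') and (x, F'), by Lagrange's
    identity.\<close>
  moreover have "x * y + H' * F' \<le> H * F"
  proof (rule power2_le_imp_le)
    have "(H * F)\<^sup>2 - (x * y + H' * F')\<^sup>2 = (x * H' - y * F')\<^sup>2"
      unfolding power_mult_distrib F2 H2 by (simp add: power2_eq_square algebra_simps)
    then show "(x * y + H' * F')\<^sup>2 \<le> (H * F)\<^sup>2"
      using zero_le_power2[of "x * H' - y * F'"] by linarith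
  qed (use nn in auto)
  ultimately have "(\<Sum>i\<in>V. h i * P f i) \<le> (1 - \<theta>) * ((1 - 1 / n) * (H * F)) + \<theta> * (H * F)"
    using theta by (smt (verit) mult_left_mono)
  also have "\<dots> = \<rho> * H * F" by (simp add: \<rho>_def algebra_simps add_divide_distrib diff_divide_distrib)
  finally show ?thesis by (simp add: F_def H_def)
qed

text \<open>First-step recursion for the probability that a walk of \<open>t\<close> steps from
  \<open>v\<close> misses \<open>u\<close>, the starting point included. The identification with
  \<open>random_walk\<close> is made in \<open>ndl_graph_avoid_bound\<close>.\<close>

primrec avoid :: "'a \<Rightarrow> nat \<Rightarrow> 'a \<Rightarrow> real" where
  "avoid u 0 = (\<lambda>v. if v = u then 0 else 1)"
| "avoid u (Suc t) = (\<lambda>v. if v = u then 0 else P (avoid u t) v)"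

lemma avoid_self [simp]: "avoid u t u = 0"
  by (cases t) auto

lemma avoid_nonneg: "v \<in> V \<Longrightarrow> 0 \<le> avoid u t v"
  by (induction t arbitrary: v) (auto simp: matrix_apply_def nonneg intro!: sum_nonneg mult_nonneg_nonneg)

text \<open>\<open>avoid u (Suc t)\<close> agrees with \<open>P (avoid u t)\<close> off
  \<open>u\<close> and is 0 at \<open>u\<close>, so its squared norm is its inner product with
  \<open>P (avoid u t)\<close>. Both functions vanish at \<open>u\<close>, so
  \<open>inner_P_vanishing\<close> applies, and one factor of the norm cancels.\<close>

lemma L2_set_avoid:
  assumes "u \<in> V"
  shows "L2_set (avoid u t) V \<le> \<rho> ^ t * sqrt n"
proof (induction t)
  case 0
  have "L2_set (avoid u 0) V \<le> L2_set (\<lambda>_. 1) V"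
    by (intro L2_set_mono) auto
  then show ?case by (simp add: L2_set_constant)
next
  case (Suc t)
  let ?f = "avoid u t" and ?h = "avoid u (Suc t)"
  have "L2_set ?h V * L2_set ?h V = (\<Sum>i\<in>V. ?h i * P ?f i)"
    unfolding power2_eq_square[symmetric] L2_set_power2
    by (intro sum.cong refl) (simp add: power2_eq_square)
  also have "\<dots> \<le> \<rho> * L2_set ?h V * L2_set ?f V"
    by (rule inner_P_vanishing[OF assms]) auto
  finally have "L2_set ?h V * L2_set ?h V \<le> L2_set ?h V * (\<rho> * L2_set ?f V)"
    by (simp add: mult_ac)
  moreover have \<rho>: "0 \<le> \<rho>" using assms rho_nonneg by auto
  ultimately have "L2_set ?h V \<le> \<rho> * L2_set ?f V"
    using L2_set_nonneg[of ?h V] L2_set_nonneg[of ?f V]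
    by (metis mult_le_cancel_left_pos mult_nonneg_nonneg order_le_less)
  also have "\<dots> \<le> \<rho> * (\<rho> ^ t * sqrt n)"
    using Suc.IH \<rho> by (rule mult_left_mono)
  finally show ?case by (simp add: mult_ac)
qed

section \<open>Mixing: from norm bounds to pointwise bounds\<close>

lemma P_mono:
  assumes "\<And>j. j \<in> V \<Longrightarrow> f j \<le> g j" "i \<in> V"
  shows "P f i \<le> P g i"
  using assms nonneg unfolding matrix_apply_def by (intro sum_mono mult_left_mono) auto

lemma avoid_add_le:
  assumes "v \<in> V"
  shows "avoid u (s + t) v \<le> (P ^^ s) (avoid u t) v"
  using assms
proof (induction s arbitrary: v)
  case (Suc s)
  have "avoid u (Suc (s + t)) v \<le> P (avoid u (s + t)) v"
  proof -
    have "0 \<le> P (avoid u (s + t)) v"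
      using Suc.prems avoid_nonneg nonneg
      by (auto simp: matrix_apply_def intro!: sum_nonneg mult_nonneg_nonneg)
    then show ?thesis by (cases "v = u") auto
  qed
  also have "\<dots> \<le> P ((P ^^ s) (avoid u t)) v"
    by (rule P_mono) (use Suc in auto)
  finally show ?case by simp
qed simp

lemma L2_set_P_power:
  assumes "(\<Sum>i\<in>V. f i) = 0"
  shows "(\<Sum>i\<in>V. (P ^^ s) f i) = 0 \<and> L2_set ((P ^^ s) f) V \<le> \<theta> ^ s * L2_set f V"
proof (induction s)
  case (Suc s)
  have "L2_set (P ((P ^^ s) f)) V \<le> \<theta> * L2_set ((P ^^ s) f) V"
    using Suc by (intro contraction) auto
  also have "\<dots> \<le> \<theta> * (\<theta> ^ s * L2_set f V)"
    using Suc theta by (intro mult_left_mono) auto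
  finally show ?case using Suc sum_P by (simp add: mult_ac)
qed (use assms in auto)

lemma P_power_split_mean:
  "i \<in> V \<Longrightarrow> (P ^^ s) f i = mean f + (P ^^ s) (\<lambda>j. f j - mean f) i"
proof (induction s arbitrary: i)
  case (Suc s)
  have "(P ^^ Suc s) f i = P (\<lambda>i. mean f * 1 + (P ^^ s) (\<lambda>j. f j - mean f) i) i"
    using Suc.IH by (auto intro!: matrix_apply_cong)
  also have "\<dots> = mean f + (P ^^ Suc s) (\<lambda>j. f j - mean f) i"
    unfolding matrix_apply_add matrix_apply_scale using row_sum[OF Suc.prems] by (simp add: matrix_apply_def)
  finally show ?case .
qed simp

text \<open>The mean is preserved by \<open>P\<close> and is at most the norm divided by
  \<open>sqrt n\<close>; the sum-zero part is bounded pointwise by its norm, which shrinks by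
  \<theta> in each step.\<close>

lemma P_power_le:
  assumes "v \<in> V"
  shows "(P ^^ s) f v \<le> (1 / sqrt n + \<theta> ^ s) * L2_set f V"
proof -
  let ?g = "\<lambda>j. f j - mean f"
  have n: "n > 0" using assms finite_V by (simp add: card_gt_0_iff) blast
  have sq: "(sqrt n * mean f)\<^sup>2 \<le> (L2_set f V)\<^sup>2" "(L2_set ?g V)\<^sup>2 \<le> (L2_set f V)\<^sup>2"
    unfolding L2_set_split_mean[of f] by (auto simp: power_mult_distrib)
  have "sqrt n * mean f \<le> L2_set f V"
    by (rule power2_le_imp_le[OF sq(1)]) simp
  then have "mean f \<le> 1 / sqrt n * L2_set f V"
    using n by (simp add: field_simps)
  moreover have "(P ^^ s) ?g v \<le> \<theta> ^ s * L2_set f V"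
  proof -
    have "(P ^^ s) ?g v \<le> L2_set ((P ^^ s) ?g) V"
      using assms finite_V by (intro member_le_L2_set)
    also have "\<dots> \<le> \<theta> ^ s * L2_set ?g V"
      using L2_set_P_power[OF sum_minus_mean] by blast
    also have "\<dots> \<le> \<theta> ^ s * L2_set f V"
      using theta by (intro mult_left_mono power2_le_imp_le[OF sq(2)]) auto
    finally show ?thesis .
  qed
  ultimately show ?thesis
    unfolding P_power_split_mean[OF assms, of s f] by (simp add: distrib_right)
qed

text \<open>Bounding a value by the norm alone would leave a factor \<open>sqrt n\<close>, which the
  union bound cannot absorb for small \<epsilon>. The \<open>s\<close> mixing steps reduce it to a
  constant.\<close>

lemma avoid_le:
  assumes "u \<in> V" "v \<in> V"
  shows "avoid u (s + t) v \<le> (1 + \<theta> ^ s * sqrt n) * \<rho> ^ t"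
proof -
  have n: "n > 0" using assms finite_V by (simp add: card_gt_0_iff) blast
  have "avoid u (s + t) v \<le> (1 / sqrt n + \<theta> ^ s) * L2_set (avoid u t) V"
    using avoid_add_le[OF assms(2)] P_power_le[OF assms(2)] by (rule order_trans)
  also have "\<dots> \<le> (1 / sqrt n + \<theta> ^ s) * (\<rho> ^ t * sqrt n)"
    using theta by (intro mult_left_mono L2_set_avoid assms) auto
  also have "\<dots> = (1 + \<theta> ^ s * sqrt n) * \<rho> ^ t"
    using n by (simp add: field_simps)
  finally show ?thesis .
qed

end

subsection \<open>Random walks on graphs\<close>

lemma measure_bind_pmf_expectation:
  "measure_pmf.prob (bind_pmf M f) A = measure_pmf.expectation M (\<lambda>x. measure_pmf.prob (f x) A)"
  unfolding measure_pmf_bind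
  by (subst measure_pmf.measure_bind[where N = "count_space UNIV"])
    (auto intro: measure_pmf_in_subprob_algebra)

lemma prob_random_walk_avoid_Suc:
  fixes G :: "'a pair_pre_digraph"
  assumes "finite (parcs G `` {v})" "parcs G `` {v} \<noteq> {}"
  shows "measure_pmf.prob (random_walk G (Suc t) v) {xs. u \<notin> set xs} =
    (if v = u then 0 else
      (\<Sum>w\<in>parcs G `` {v}. measure_pmf.prob (random_walk G t w) {xs. u \<notin> set xs}) /
        real (card (parcs G `` {v})))"
proof -
  have pre: "(#) v -` {xs. u \<notin> set xs} = (if v = u then {} else {xs. u \<notin> set xs})"
    by auto
  have "measure_pmf.prob (random_walk G (Suc t) v) {xs. u \<notin> set xs} =
      measure_pmf.expectation (pmf_of_set (parcs G `` {v}))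
        (\<lambda>w. measure_pmf.prob (map_pmf ((#) v) (random_walk G t w)) {xs. u \<notin> set xs})"
    by (simp only: random_walk.simps measure_bind_pmf_expectation)
  also have "\<dots> = (\<Sum>w\<in>parcs G `` {v}.
      measure_pmf.prob (map_pmf ((#) v) (random_walk G t w)) {xs. u \<notin> set xs}) /
        real (card (parcs G `` {v}))"
    using assms by (intro integral_pmf_of_set) auto
  finally show ?thesis by (simp add: measure_map_pmf pre)
qed

lemma cover_prob_ge_union_bound:
  fixes G :: "'a pair_pre_digraph"
  assumes "finite (pverts G)"
  shows "cover_prob G t v \<ge>
    1 - (\<Sum>u\<in>pverts G. measure_pmf.prob (random_walk G t v) {xs. u \<notin> set xs})"
proof -
  let ?M = "random_walk G t v"
  have "1 - cover_prob G t v = measure_pmf.prob ?M (UNIV - {xs. pverts G \<subseteq> set xs})"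
    unfolding cover_prob_def by (subst measure_pmf.prob_compl[symmetric]) auto
  also have "UNIV - {xs. pverts G \<subseteq> set xs} = (\<Union>u\<in>pverts G. {xs. u \<notin> set xs})"
    by auto
  also have "measure_pmf.prob ?M \<dots> \<le> (\<Sum>u\<in>pverts G. measure_pmf.prob ?M {xs. u \<notin> set xs})"
    using assms by (intro measure_pmf.finite_measure_subadditive_finite) auto
  finally show ?thesis by simp
qed

text \<open>The norm on sum-zero vectors is attained as the modulus of an eigenvalue that survives
  the removal of one copy of \<open>d\<close>, hence is at most \<open>lam\<close>. The case split
  provides the nonzero sum-zero vector that \<open>extremal_centered_eigenvector\<close> asks for;
  there is none if \<open>n = 1\<close>.\<close>

lemma ndl_graph_centered_contraction:
  assumes "ndl_graph n d lam G"
    and row: "\<And>i. i < n \<Longrightarrow> (\<Sum>j<n. of_bool ((i, j) \<in> parcs G)) = real d"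
    and sym: "\<And>i j. (i, j) \<in> parcs G \<longleftrightarrow> (j, i) \<in> parcs G"
    and f: "(\<Sum>i<n. f i) = 0"
  shows "L2_set (matrix_apply {..<n} (\<lambda>i j. of_bool ((i, j) \<in> parcs G)) f) {..<n} \<le> lam * L2_set f {..<n}"
proof (cases "\<exists>i<n. f i \<noteq> 0")
  case True
  let ?a = "\<lambda>i j. of_bool ((i, j) \<in> parcs G) :: real"
  obtain g \<mu> where g: "(\<Sum>i<n. g i) = 0" "\<exists>i\<in>{..<n}. g i \<noteq> 0"
    "\<And>i. i \<in> {..<n} \<Longrightarrow> matrix_apply {..<n} ?a g i = \<mu> * g i"
    "\<And>f. (\<Sum>i<n. f i) = 0 \<Longrightarrow> L2_set (matrix_apply {..<n} ?a f) {..<n} \<le> \<bar>\<mu>\<bar> * L2_set f {..<n}"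
  proof (rule extremal_centered_eigenvector[of "{..<n}" ?a "real d" f])
    show "?a i j = ?a j i" for i j using sym by simp
  qed (use True f row in auto)
  have "\<mu> \<in># proots (char_poly (mat n n (\<lambda>(i, j). ?a i j))) - {#real d#}"
    by (rule centered_eigenvalue_in_proots[where g = g])
      (use g row in \<open>auto simp: matrix_apply_def\<close>)
  moreover have "mat n n (\<lambda>(i, j). ?a i j) = adjacency_matrix n G"
    by (auto simp: adjacency_matrix_def)
  ultimately have "\<bar>\<mu>\<bar> \<le> lam" using assms(1) by (auto simp: ndl_graph_def)
  then show ?thesis using g(4)[OF f] by (meson L2_set_nonneg mult_right_mono order_trans)
next
  case False
  then have "matrix_apply {..<n} a f i = 0" for a i
    by (simp add: matrix_apply_def)
  moreover have "L2_set f {..<n} = 0" using False by (simp add: L2_set_eq_0_iff)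
  ultimately show ?thesis by (simp add: L2_set_def)
qed

text \<open>Here \<theta> is any upper bound for \<open>lam / d\<close> in [0,1], so the estimate
  depends on the graph only through \<open>n\<close>.\<close>

lemma ndl_graph_avoid_bound:
  assumes ndl: "ndl_graph n d lam G" and \<theta>: "lam \<le> \<theta> * real d" "0 \<le> \<theta>" "\<theta> \<le> 1" and d: "d > 0"
    and uv: "u < n" "v < n"
  shows "measure_pmf.prob (random_walk G (s + t) v) {xs. u \<notin> set xs}
    \<le> (1 + \<theta> ^ s * sqrt (real n)) * (1 - (1 - \<theta>) / real n) ^ t"
proof -
  interpret pair_graph G using ndl by (simp add: ndl_graph_def)
  have V: "pverts G = {0..<n}" using ndl by (simp add: ndl_graph_def)
  have sym: "(i, j) \<in> parcs G \<longleftrightarrow> (j, i) \<in> parcs G" for i j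
    using arcs_symmetric by blast
  have nb: "parcs G `` {i} \<subseteq> {..<n}" for i
    using in_arcsD2 V by fastforce
  then have fin: "finite (parcs G `` {i})" for i
    using finite_subset by blast
  have card: "card (parcs G `` {i}) = d" if "i < n" for i
  proof -
    have "out_degree (with_proj G) i = d" using ndl that by (simp add: ndl_graph_def)
    moreover have "out_arcs (with_proj G) i = Pair i ` (parcs G `` {i})"
      by (auto simp: out_arcs_def)
    ultimately show ?thesis by (simp add: out_degree_def card_image inj_on_def)
  qed
  have nb_sum: "(\<Sum>j<n. of_bool ((i, j) \<in> parcs G) * f j) = (\<Sum>j\<in>parcs G `` {i}. f j)"
    for i and f :: "nat \<Rightarrow> real"
  proof -
    have "(\<Sum>j\<in>parcs G `` {i}. f j) = (\<Sum>j\<in>parcs G `` {i}. of_bool ((i, j) \<in> parcs G) * f j)"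
      by (intro sum.cong refl) auto
    also have "\<dots> = (\<Sum>j<n. of_bool ((i, j) \<in> parcs G) * f j)"
      by (intro sum.mono_neutral_left nb) auto
    finally show ?thesis by simp
  qed
  have row: "(\<Sum>j<n. of_bool ((i, j) \<in> parcs G)) = real d" if "i < n" for i
    using nb_sum[of i "\<lambda>_. 1"] card[OF that] by simp
  define p where "p i j = of_bool ((i, j) \<in> parcs G) / real d" for i j
  have p_apply: "matrix_apply {..<n} p f i =
      inverse (real d) * matrix_apply {..<n} (\<lambda>i j. of_bool ((i, j) \<in> parcs G)) f i" for f i
    unfolding matrix_apply_def p_def sum_distrib_left by (intro sum.cong refl) (simp add: field_simps)
  interpret contracting_kernel "{..<n}" p \<theta>
  proof
    fix f :: "nat \<Rightarrow> real" assume f: "(\<Sum>i<n. f i) = 0"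
    let ?b = "matrix_apply {..<n} (\<lambda>i j. of_bool ((i, j) \<in> parcs G)) f"
    have "L2_set ?b {..<n} \<le> lam * L2_set f {..<n}"
      by (rule ndl_graph_centered_contraction[OF ndl row sym f])
    also have "\<dots> \<le> \<theta> * real d * L2_set f {..<n}"
      using \<theta>(1) by (rule mult_right_mono) simp
    finally have "inverse (real d) * L2_set ?b {..<n} \<le> \<theta> * L2_set f {..<n}"
      using d by (simp add: field_simps)
    then show "L2_set (matrix_apply {..<n} p f) {..<n} \<le> \<theta> * L2_set f {..<n}"
      unfolding p_apply using d by (subst (asm) L2_set_right_distrib) auto
  qed (use \<theta> d row sym in \<open>auto simp: p_def sum_divide_distrib[symmetric]\<close>)
  \<comment> \<open>First-step analysis identifies the walk with the recursion
    \<open>avoid\<close>.\<close>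
  have "measure_pmf.prob (random_walk G t v) {xs. u \<notin> set xs} = avoid u t v" if "v < n" for t v
    using that
  proof (induction t arbitrary: v)
    case 0
    then show ?case by (simp add: indicator_def)
  next
    case (Suc t)
    have ne: "parcs G `` {v} \<noteq> {}" using card[OF Suc.prems] d by force
    have "(\<Sum>w\<in>parcs G `` {v}. measure_pmf.prob (random_walk G t w) {xs. u \<notin> set xs}) / real d
        = (\<Sum>w\<in>parcs G `` {v}. avoid u t w) / real d"
      using nb by (intro arg_cong2[where f = "(/)"] sum.cong refl Suc.IH) auto
    also have "\<dots> = matrix_apply {..<n} p (avoid u t) v"
      unfolding p_apply by (simp add: matrix_apply_def nb_sum field_simps)
    finally show ?case
      unfolding prob_random_walk_avoid_Suc[OF fin ne] card[OF Suc.prems] by simp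
  qed
  then show ?thesis using avoid_le[of u v s t] uv by (simp add: \<rho>_def)
qed

lemma cover_prob_ndl_graph:
  assumes "ndl_graph n d lam G" "lam \<le> \<theta> * real d" "0 \<le> \<theta>" "\<theta> \<le> 1" "d > 0" "v < n"
  shows "cover_prob G (s + t) v \<ge>
    1 - real n * ((1 + \<theta> ^ s * sqrt (real n)) * (1 - (1 - \<theta>) / real n) ^ t)"
proof -
  have V: "pverts G = {0..<n}" using assms by (simp add: ndl_graph_def)
  have "(\<Sum>u\<in>pverts G. measure_pmf.prob (random_walk G (s + t) v) {xs. u \<notin> set xs})
      \<le> (\<Sum>u\<in>pverts G. (1 + \<theta> ^ s * sqrt (real n)) * (1 - (1 - \<theta>) / real n) ^ t)"
    using assms V by (intro sum_mono ndl_graph_avoid_bound) auto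
  then show ?thesis using cover_prob_ge_union_bound[of G "s + t" v] V by simp
qed

text \<open>This \<theta> solves (1 - \<theta>) (1 + \<epsilon>) = 1 + \<epsilon> / 2: half of the
  slack pays for the imperfect spectral gap, the other half survives as the power of
  \<open>n\<close>. The \<open>s\<close> mixing steps and the rounding cost only the factor
  \<open>exp 3\<close>.\<close>

lemma miss_bound_at_cover_time:
  fixes \<epsilon> \<theta> :: real
  assumes "\<epsilon> > 0" and \<theta>: "\<theta> = \<epsilon> / (2 * (1 + \<epsilon>))"
    and n: "n \<ge> 3" and T: "T = nat \<lfloor>(1 + \<epsilon>) * real n * ln (real n)\<rfloor>" and s: "s = nat \<lceil>ln (real n)\<rceil>"
  shows "s \<le> T"
    and "real n * ((1 + \<theta> ^ s * sqrt (real n)) * (1 - (1 - \<theta>) / real n) ^ (T - s))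
      \<le> 2 * exp 3 * real n powr (- \<epsilon> / 2)"
proof -
  have \<theta>b: "0 < \<theta>" "\<theta> < 1 / 2" using assms(1) by (auto simp: \<theta> field_simps)
  have l0: "ln (real n) > 0" and ln: "ln (real n) \<le> real n - 1"
    using n ln_le_minus_one[of "real n"] by auto
  \<comment> \<open>Makes \<open>ln n + 1 \<le> 3 * ln n - 1\<close>, which gives
    \<open>s \<le> T\<close> despite both roundings.\<close>
  have l1: "ln (real n) \<ge> 1"
  proof -
    have "exp 1 \<le> real n" using exp_le n by linarith
    then show ?thesis using n by (simp add: ln_ge_iff)
  qed
  have T1: "real T \<le> (1 + \<epsilon>) * real n * ln (real n)" "real T \<ge> (1 + \<epsilon>) * real n * ln (real n) - 1"
  proof -
    have "real T = of_int \<lfloor>(1 + \<epsilon>) * real n * ln (real n)\<rfloor>"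
      using assms(1) l0 unfolding T by (intro of_nat_nat) simp
    then show "real T \<le> (1 + \<epsilon>) * real n * ln (real n)"
      "real T \<ge> (1 + \<epsilon>) * real n * ln (real n) - 1" by linarith+
  qed
  have s1: "real s \<ge> ln (real n)" "real s \<le> ln (real n) + 1"
  proof -
    have "real s = of_int \<lceil>ln (real n)\<rceil>"
      using l0 unfolding s by (intro of_nat_nat) simp
    then show "real s \<ge> ln (real n)" "real s \<le> ln (real n) + 1" by linarith+
  qed
  have "(1 + \<epsilon>) * real n * ln (real n) \<ge> 3 * ln (real n)"
  proof -
    have "1 * 3 \<le> (1 + \<epsilon>) * real n" using assms(1) n by (intro mult_mono) auto
    then show ?thesis using l0 by (intro mult_right_mono) auto
  qed
  then show sT: "s \<le> T" using T1 s1 l1 by linarith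
  \<comment> \<open>As \<theta> < 1/2 \<le> \<open>exp (- 1 / 2)\<close> and \<open>s\<close> is at
    least \<open>ln n\<close>, the power is at most \<open>1 / sqrt n\<close>.\<close>
  have "\<theta> ^ s * sqrt (real n) \<le> 1"
  proof -
    have "\<theta> \<le> exp (- 1 / 2)"
    proof -
      have "exp (1 / 2 :: real) \<le> 2" by (rule exp_half_le2)
      then have "1 / 2 \<le> exp (- 1 / 2 :: real)" by (simp add: exp_minus field_simps)
      then show ?thesis using \<theta>b by linarith
    qed
    then have "\<theta> ^ s \<le> exp (- 1 / 2) ^ s" using \<theta>b by (intro power_mono) auto
    also have "\<dots> = exp (- real s / 2)" by (simp add: exp_of_nat_mult[symmetric])
    also have "\<dots> \<le> exp (- ln (real n) / 2)" using s1 by simp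
    finally have "\<theta> ^ s * sqrt (real n) \<le> exp (- ln (real n) / 2) * sqrt (real n)"
      by (rule mult_right_mono) simp
    also have "\<dots> = exp (- ln (real n) / 2) * exp (ln (real n) / 2)"
      using n by (simp add: powr_half_sqrt[symmetric] powr_def)
    also have "\<dots> = 1" by (simp add: exp_add[symmetric])
    finally show ?thesis .
  qed
  then have a: "1 + \<theta> ^ s * sqrt (real n) \<le> 2" by simp
  have "(1 - (1 - \<theta>) / real n) ^ (T - s) \<le> exp (- (1 - \<theta>) / real n) ^ (T - s)"
    using exp_ge_add_one_self[of "- (1 - \<theta>) / real n"] \<theta>b n
    by (intro power_mono) (auto simp: field_simps)
  also have "\<dots> = exp (- (1 - \<theta>) * (real T - real s) / real n)"
    using sT by (simp add: exp_of_nat_mult[symmetric] of_nat_diff)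
  also have "\<dots> \<le> exp (- (1 + \<epsilon> / 2) * ln (real n) + 3)"
  proof -
    \<comment> \<open>The 2 collects the floor in \<open>T\<close> and the ceiling in
      \<open>s\<close>. The whole loss is at most \<open>3 * n\<close>, hence the 3 in the exponent
      after division by \<open>n\<close>.\<close>
    have "(1 - \<theta>) * (real T - real s) \<ge> (1 - \<theta>) * ((1 + \<epsilon>) * real n * ln (real n) - ln (real n) - 2)"
      using T1 s1 \<theta>b by (intro mult_left_mono) auto
    also have "(1 - \<theta>) * ((1 + \<epsilon>) * real n * ln (real n) - ln (real n) - 2)
        = (1 - \<theta>) * (1 + \<epsilon>) * real n * ln (real n) - (1 - \<theta>) * (ln (real n) + 2)"
      by (simp add: algebra_simps)
    also have "(1 - \<theta>) * (1 + \<epsilon>) = 1 + \<epsilon> / 2"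
      using assms(1) unfolding \<theta> by (simp add: field_simps)
    finally have "(1 + \<epsilon> / 2) * real n * ln (real n) - (1 - \<theta>) * (ln (real n) + 2)
        \<le> (1 - \<theta>) * (real T - real s)" .
    moreover have "(1 - \<theta>) * (ln (real n) + 2) \<le> 1 * (3 * real n)"
      using \<theta>b l0 ln n by (intro mult_mono) auto
    ultimately have "(1 + \<epsilon> / 2) * real n * ln (real n) - 3 * real n \<le> (1 - \<theta>) * (real T - real s)"
      by linarith
    then show ?thesis using n by (simp add: field_simps)
  qed
  also have "\<dots> = exp 3 * real n powr (- \<epsilon> / 2) / real n"
  proof -
    have "- (1 + \<epsilon> / 2) * ln (real n) + 3 = 3 + (- \<epsilon> / 2) * ln (real n) - ln (real n)"
      by (simp add: algebra_simps)
    then show ?thesis using n by (simp add: exp_add exp_diff powr_def)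
  qed
  finally have b: "(1 - (1 - \<theta>) / real n) ^ (T - s) \<le> exp 3 * real n powr (- \<epsilon> / 2) / real n" .
  have nn: "0 \<le> 1 - (1 - \<theta>) / real n" using \<theta>b n by (simp add: field_simps)
  have "real n * ((1 + \<theta> ^ s * sqrt (real n)) * (1 - (1 - \<theta>) / real n) ^ (T - s))
      \<le> real n * (2 * (exp 3 * real n powr (- \<epsilon> / 2) / real n))"
    using a b nn by (intro mult_left_mono mult_mono) auto
  then show "real n * ((1 + \<theta> ^ s * sqrt (real n)) * (1 - (1 - \<theta>) / real n) ^ (T - s))
      \<le> 2 * exp 3 * real n powr (- \<epsilon> / 2)"
    using n by simp
qed

theorem theorem1p2:
  fixes \<epsilon> :: real
  assumes "\<epsilon> > 0"
  shows "\<exists>C>0. \<forall>\<delta>>0. \<forall>\<^sub>F n in sequentially.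
    \<forall>(d::nat) (lam::real) (G::nat pair_pre_digraph).
      ndl_graph n d lam G \<and> real d / lam \<ge> C \<longrightarrow>
        ereal_of_enat (strong_cover_time \<delta> G) \<le> ereal ((1 + \<epsilon>) * real n * ln (real n)) \<and>
        (\<forall>v\<in>pverts G. cover_prob G (nat \<lfloor>(1 + \<epsilon>) * real n * ln (real n)\<rfloor>) v \<ge> 1 - \<delta>)"
proof -
  define \<theta> where "\<theta> = \<epsilon> / (2 * (1 + \<epsilon>))"
  have \<theta>: "0 < \<theta>" "\<theta> \<le> 1" using assms by (auto simp: \<theta>_def field_simps)
  show ?thesis
  proof (intro exI[of _ "1 / \<theta>"] conjI allI impI)
    show "1 / \<theta> > 0" using \<theta> by simp
    fix \<delta> :: real assume \<delta>: "\<delta> > 0"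
    have "((\<lambda>n. 2 * exp 3 * real n powr (- \<epsilon> / 2)) \<longlongrightarrow> 2 * exp 3 * 0) sequentially"
      using assms
      by (intro tendsto_intros tendsto_neg_powr filterlim_real_sequentially) auto
    then have "\<forall>\<^sub>F n in sequentially. 2 * exp 3 * real n powr (- \<epsilon> / 2) < \<delta>"
      using \<delta> by (intro order_tendstoD) auto
    then show "\<forall>\<^sub>F n in sequentially. \<forall>d lam G. ndl_graph n d lam G \<and> real d / lam \<ge> 1 / \<theta> \<longrightarrow>
        ereal_of_enat (strong_cover_time \<delta> G) \<le> ereal ((1 + \<epsilon>) * real n * ln (real n)) \<and>
        (\<forall>v\<in>pverts G. cover_prob G (nat \<lfloor>(1 + \<epsilon>) * real n * ln (real n)\<rfloor>) v \<ge> 1 - \<delta>)"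
      using eventually_ge_at_top[of 3]
    proof eventually_elim
      \<comment> \<open>The threshold on \<open>n\<close> depends only on \<epsilon> and \<delta>;
        \<open>d\<close>, \<open>lam\<close> and \<open>G\<close> are fixed afterwards.\<close>
      case (elim n)
      define T where "T = nat \<lfloor>(1 + \<epsilon>) * real n * ln (real n)\<rfloor>"
      define s where "s = nat \<lceil>ln (real n)\<rceil>"
      note bound = miss_bound_at_cover_time[OF assms \<theta>_def elim(2) T_def s_def]
      show ?case
      proof (intro allI impI)
        fix d lam G assume G: "ndl_graph n d lam G \<and> real d / lam \<ge> 1 / \<theta>"
        \<comment> \<open>Division by 0 yields 0, so a positive quotient forces
          \<open>lam > 0\<close> and \<open>d > 0\<close>; in particular every vertex has a
          neighbour.\<close>
        have "real d / lam > 0" using G \<theta> by (auto intro: less_le_trans[of 0 "1 / \<theta>"])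
        then have pos: "d > 0" "lam > 0" by (auto simp: zero_less_divide_iff)
        then have lam: "lam \<le> \<theta> * real d" using G \<theta> by (simp add: field_simps)
        have V: "pverts G = {0..<n}" using G by (simp add: ndl_graph_def)
        have cover: "cover_prob G T v \<ge> 1 - \<delta>" if "v \<in> pverts G" for v
          using cover_prob_ndl_graph[of n d lam G \<theta> v s "T - s"] G lam \<theta> pos that V bound elim(1)
          by simp
        have "strong_cover_time \<delta> G \<le> enat T"
          unfolding strong_cover_time_def using cover by (intro Inf_lower) auto
        then have "ereal_of_enat (strong_cover_time \<delta> G) \<le> ereal_of_enat (enat T)"
          by (simp only: ereal_of_enat_le_iff)
        also have "\<dots> = ereal (real T)" by simp
        also have "real T \<le> (1 + \<epsilon>) * real n * ln (real n)"
          unfolding T_def using assms elim(2) by (simp add: of_nat_nat)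
        finally show "ereal_of_enat (strong_cover_time \<delta> G) \<le> ereal ((1 + \<epsilon>) * real n * ln (real n)) \<and>
            (\<forall>v\<in>pverts G. cover_prob G (nat \<lfloor>(1 + \<epsilon>) * real n * ln (real n)\<rfloor>) v \<ge> 1 - \<delta>)"
          using cover by (simp add: T_def)
      qed
    qed
  qed
qed

end
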